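(* Let $g=\begin{bmatrix}A&b\\c^T&d\end{bmatrix}\in G=GL(n+1,\mathbb{R})$ and let $F\in\mathcal{SM}_2(\mathbb{R}^n)$ be a simple quadratic natural exponential family on $\mathbb{R}^n$, with variance function $V_F$ and domain of the means $M_F$. Then $T_g(V_F)$ is a matrix polynomial of degree $\le 3$: on its domain $(M_F)_g$ all the entries of $m\mapsto T_g(V_F)(m)$ are polynomials in $m=(m_1,\dots,m_n)$ of total degree $\le 3$.
   Context: For a positive measure $\mu$ on $\mathbb{R}^n$ let $L_\mu(\theta)=\int e^{\langle\theta,x\rangle}\mu(dx)$, $\Theta(\mu)$ the interior of $\{L_\mu<\infty\}$, $k_\mu=\log L_\mu$. When $\Theta(\mu)\neq\emptyset$ and $\mu$ is not concentrated on an affine hyperplane, the natural exponential family (NEF) generated by $\mu$ is $F(\mu)=\{e^{\langle\theta,x\rangle-k_\mu(\theta)}\mu(dx):\theta\in\Theta(\mu)\}$; its domain of the means is the open set $M_F=k_\mu'(\Theta(\mu))$, and its variance function is $V_F(m)=k_\mu''(\psi_\mu(m))$ for $m\in M_F$, where $\psi_\mu$ is the inverse of the diffeomorphism $k'_\mu:\Theta(\mu)\to M_F$. $\mathcal{SM}_2(\mathbb{R}^n)$ (the Casalis class, simple quadratic families) is the set of NEFs $F$ on $\mathbb{R}^n$ with $V_F(m)=a\,mm^T+B(m)+C$ on $M_F$, where $a\in\mathbb{R}$, $B(m)=B_1m_1+\cdots+B_nm_n$, and $B_1,\dots,B_n,C$ are constant symmetric $n\times n$ matrices. For $g=\begin{bmatrix}A&b\\c^T&d\end{bmatrix}\in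 G$ ($A$ an $n\times n$ matrix, $b,c\in\mathbb{R}^n$, $d\in\mathbb{R}$) put $h_g(m)=\frac{Am+b}{c^Tm+d}$ for $c^Tm+d\ne0$, with (invertible) Jacobian matrix $h_g'(m)$. For an open set $U\subset\mathbb{R}^n$, $U_g=\{m: c^Tm+d>0,\ h_g(m)\in U\}$. If $V$ is a matrix-valued map on $U$, then for $m\in U_g$ $$T_g(V)(m)=\frac{1}{c^Tm+d}\,(h'_g(m))^{-1}\,V(h_g(m))\,(h'_g(m)^T)^{-1}.$$ *)

theory Defs
  imports "HOL-Analysis.Analysis"
begin

definition laplace :: "(real^'n) measure \<Rightarrow> real^'n \<Rightarrow> ennreal" where
  "laplace \<mu> \<theta> = (\<integral>\<^sup>+ x. ennreal (exp (\<theta> \<bullet> x)) \<partial>\<mu>)"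

definition Theta :: "(real^'n) measure \<Rightarrow> (real^'n) set" where
  "Theta \<mu> = interior {\<theta>. laplace \<mu> \<theta> < \<infinity>}"

definition cumulant :: "(real^'n) measure \<Rightarrow> real^'n \<Rightarrow> real" where
  "cumulant \<mu> \<theta> = ln (enn2real (laplace \<mu> \<theta>))"

definition grad :: "(real^'n \<Rightarrow> real) \<Rightarrow> real^'n \<Rightarrow> real^'n" where
  "grad f x = (\<chi> i. frechet_derivative f (at x) (axis i 1))"

definition hessian :: "(real^'n \<Rightarrow> real) \<Rightarrow> real^'n \<Rightarrow> real^'n^'n" where
  "hessian f x = jacobian (grad f) (at x)"

definition nef_generator :: "(real^'n) measure \<Rightarrow> bool" where
  "nef_generator \<mu> \<longleftrightarrow> sets \<mu> = sets borel \<and> Theta \<mu> \<noteq> {} \<and>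
     (\<nexists>a b. a \<noteq> 0 \<and> (AE x in \<mu>. a \<bullet> x = b))"

definition nef :: "(real^'n) measure \<Rightarrow> (real^'n) measure set" where
  "nef \<mu> = (\<lambda>\<theta>. density \<mu> (\<lambda>x. ennreal (exp (\<theta> \<bullet> x - cumulant \<mu> \<theta>)))) ` Theta \<mu>"

definition NEFs :: "(real^'n) measure set set" where
  "NEFs = nef ` {\<mu>. nef_generator \<mu>}"

text \<open>Two generators of the same family differ by a factor \<open>exp (a \<bullet> x + b)\<close>, so their
  cumulants differ by a translation of the argument and an additive constant.
  The domain of the means and the variance function defined below therefore do not
  depend on which generator is chosen.\<close>

definition generator :: "(real^'n) measure set \<Rightarrow> (real^'n) measure" where
  "generator F = (SOME \<mu>. nef_generator \<mu> \<and> nef \<mu> = F)"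

definition means_domain :: "(real^'n) measure set \<Rightarrow> (real^'n) set" where
  "means_domain F = grad (cumulant (generator F)) ` Theta (generator F)"

definition psi :: "(real^'n) measure \<Rightarrow> real^'n \<Rightarrow> real^'n" where
  "psi \<mu> = the_inv_into (Theta \<mu>) (grad (cumulant \<mu>))"

text \<open>Only the values at points of \<open>means_domain F\<close> are meaningful.\<close>

definition variance_function :: "(real^'n) measure set \<Rightarrow> real^'n \<Rightarrow> real^'n^'n" where
  "variance_function F m = hessian (cumulant (generator F)) (psi (generator F) m)"

definition SM2 :: "(real^'n) measure set set" where
  "SM2 = {F \<in> NEFs. \<exists>(a::real) (B :: 'n \<Rightarrow> real^'n^'n) (C :: real^'n^'n).
     (\<forall>i. transpose (B i) = B i) \<and> transpose C = C \<and>
     (\<forall>m \<in> means_domain F.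
        variance_function F m =
          a *\<^sub>R (\<chi> i j. m $ i * m $ j) + (\<Sum>i\<in>UNIV. m $ i *\<^sub>R B i) + C)}"

text \<open>Matrices of size \<open>n + 1\<close> are indexed by \<^typ>\<open>'n option\<close>; the index \<^term>\<open>None\<close> is
  the last row and column.\<close>

type_synonym 'n bordered = "real^('n option)^('n option)"

definition blockA :: "'n::finite bordered \<Rightarrow> real^'n^'n" where
  "blockA g = (\<chi> i j. g $ Some i $ Some j)"

definition blockb :: "'n::finite bordered \<Rightarrow> real^'n" where
  "blockb g = (\<chi> i. g $ Some i $ None)"

definition blockc :: "'n::finite bordered \<Rightarrow> real^'n" where
  "blockc g = (\<chi> j. g $ None $ Some j)"

definition blockd :: "'n::finite bordered \<Rightarrow> real" where
  "blockd g = g $ None $ None"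

definition proj_denom :: "'n::finite bordered \<Rightarrow> real^'n \<Rightarrow> real" where
  "proj_denom g m = blockc g \<bullet> m + blockd g"

definition proj_map :: "'n::finite bordered \<Rightarrow> real^'n \<Rightarrow> real^'n" where
  "proj_map g m = (1 / proj_denom g m) *\<^sub>R (blockA g *v m + blockb g)"

definition proj_domain :: "'n::finite bordered \<Rightarrow> (real^'n) set \<Rightarrow> (real^'n) set" where
  "proj_domain g U = {m. proj_denom g m > 0 \<and> proj_map g m \<in> U}"

text \<open>Meaningful for \<open>m\<close> in the domain above: there \<open>proj_map g\<close> is differentiable, and its
  Jacobian is invertible if \<open>g\<close> is.\<close>

definition T_action ::
  "'n::finite bordered \<Rightarrow> (real^'n \<Rightarrow> real^'n^'n) \<Rightarrow> real^'n \<Rightarrow> real^'n^'n" where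
  "T_action g V m =
     (let J = jacobian (proj_map g) (at m)
      in (1 / proj_denom g m) *\<^sub>R
           (matrix_inv J ** V (proj_map g m) ** matrix_inv (transpose J)))"

definition poly_fun_deg_le :: "nat \<Rightarrow> (real^'n \<Rightarrow> real) \<Rightarrow> bool" where
  "poly_fun_deg_le d f \<longleftrightarrow>
     (\<exists>c :: ('n \<Rightarrow> nat) \<Rightarrow> real. \<forall>x.
        f x = (\<Sum>\<alpha> | sum \<alpha> UNIV \<le> d. c \<alpha> * (\<Prod>i\<in>UNIV. x $ i ^ \<alpha> i)))"

text \<open>The index set of the sum is finite, so the sum is not vacuously zero.\<close>

lemma finite_multi_indices: "finite {\<alpha> :: 'n::finite \<Rightarrow> nat. sum \<alpha> UNIV \<le> d}"
proof (rule finite_subset)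
  show "{\<alpha> :: 'n \<Rightarrow> nat. sum \<alpha> UNIV \<le> d} \<subseteq> Pi\<^sub>E UNIV (\<lambda>_. {..d})"
  proof
    fix \<alpha> :: "'n \<Rightarrow> nat" assume "\<alpha> \<in> {\<alpha>. sum \<alpha> UNIV \<le> d}"
    moreover have "\<alpha> i \<le> sum \<alpha> UNIV" for i
      by (rule member_le_sum) auto
    ultimately show "\<alpha> \<in> Pi\<^sub>E UNIV (\<lambda>_. {..d})"
      by (auto intro: order_trans)
  qed
qed (auto intro: finite_PiE)

end

theory Submission imports Defs begin

text \<open>With \<open>g\<inverse>\<close> written in blocks \<open>A', b', c', d'\<close> and \<open>\<delta> = c \<bullet> m + d\<close>, differentiating the
  inverse map shows that the inverse Jacobian of \<open>h = h\<^sub>g\<close> at \<open>m\<close> is \<open>\<delta> K\<close> with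
  \<open>K = A' - m c'\<^sup>T\<close> affine in \<open>m\<close>. Hence \<open>T\<^sub>g(V)(m) = K (\<delta> V(h(m))) K\<^sup>T\<close>. The affine part of
  \<open>V\<close> contributes an affine function of \<open>m\<close> to \<open>\<delta> V(h(m))\<close>, and the quadratic part
  \<open>a h h\<^sup>T\<close> contributes \<open>a \<delta> w w\<^sup>T\<close> to the product because \<open>K h(m) = w\<close> with
  \<open>w = d' m - b'\<close>, in which the denominator has disappeared. Every term is thus a product of
  three affine functions.\<close>

section \<open>Polynomial functions of bounded degree\<close>

lemma poly_fun_deg_le_monomial:
  fixes \<alpha> :: "'n::finite \<Rightarrow> nat"
  assumes "sum \<alpha> UNIV \<le> d"
  shows "poly_fun_deg_le d (\<lambda>x. k * (\<Prod>i\<in>UNIV. x $ i ^ \<alpha> i))"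
  unfolding poly_fun_deg_le_def
proof (intro exI[of _ "\<lambda>\<beta>. if \<beta> = \<alpha> then k else 0"] allI)
  fix x :: "real^'n"
  have "(\<Sum>\<beta> | sum \<beta> UNIV \<le> d. (if \<beta> = \<alpha> then k else 0) * (\<Prod>i\<in>UNIV. x $ i ^ \<beta> i))
      = (\<Sum>\<beta> | sum \<beta> UNIV \<le> d. if \<beta> = \<alpha> then k * (\<Prod>i\<in>UNIV. x $ i ^ \<alpha> i) else 0)"
    by (intro sum.cong) auto
  then show "k * (\<Prod>i\<in>UNIV. x $ i ^ \<alpha> i) =
      (\<Sum>\<beta> | sum \<beta> UNIV \<le> d. (if \<beta> = \<alpha> then k else 0) * (\<Prod>i\<in>UNIV. x $ i ^ \<beta> i))"
    using assms by (simp add: sum.delta finite_multi_indices)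
qed

lemma poly_fun_deg_le_const: "poly_fun_deg_le d (\<lambda>x :: real^'n::finite. k)"
  using poly_fun_deg_le_monomial[of "\<lambda>_ :: 'n. 0" d k] by simp

lemma poly_fun_deg_le_coord:
  assumes "1 \<le> d"
  shows "poly_fun_deg_le d (\<lambda>x :: real^'n::finite. x $ i)"
proof -
  have "(\<Prod>j\<in>UNIV. x $ j ^ (if j = i then 1 else 0)) = x $ i" for x :: "real^'n"
    by (simp add: if_distrib[of "\<lambda>e. _ ^ e"] cong: if_cong)
  then show ?thesis
    using poly_fun_deg_le_monomial[of "\<lambda>j. if j = i then 1 else 0" d 1] assms by simp
qed

lemma poly_fun_deg_le_add:
  fixes p q :: "real^'n::finite \<Rightarrow> real"
  assumes "poly_fun_deg_le d p" "poly_fun_deg_le d q"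
  shows "poly_fun_deg_le d (\<lambda>x. p x + q x)"
proof -
  from assms obtain a b where
    "\<And>x. p x = (\<Sum>\<alpha> | sum \<alpha> UNIV \<le> d. a \<alpha> * (\<Prod>i\<in>UNIV. x $ i ^ \<alpha> i))"
    "\<And>x. q x = (\<Sum>\<alpha> | sum \<alpha> UNIV \<le> d. b \<alpha> * (\<Prod>i\<in>UNIV. x $ i ^ \<alpha> i))"
    unfolding poly_fun_deg_le_def by auto
  then show ?thesis
    unfolding poly_fun_deg_le_def
    by (intro exI[of _ "\<lambda>\<alpha>. a \<alpha> + b \<alpha>"]) (simp add: sum.distrib ring_distribs)
qed

lemma poly_fun_deg_le_sum:
  fixes p :: "'a \<Rightarrow> real^'n::finite \<Rightarrow> real"
  assumes "\<And>s. s \<in> S \<Longrightarrow> poly_fun_deg_le d (p s)"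
  shows "poly_fun_deg_le d (\<lambda>x. \<Sum>s\<in>S. p s x)"
  using assms
  by (induction S rule: infinite_finite_induct)
    (auto intro: poly_fun_deg_le_add poly_fun_deg_le_const)

text \<open>Expanding both factors gives a double sum of monomials with exponents
  \<open>\<alpha> i + \<beta> i\<close>, of total degree at most \<open>d + e\<close>. Closure under
  sums then suffices, and the coefficients need not be convolved.\<close>

lemma poly_fun_deg_le_mult:
  fixes p q :: "real^'n::finite \<Rightarrow> real"
  assumes "poly_fun_deg_le d p" "poly_fun_deg_le e q"
  shows "poly_fun_deg_le (d + e) (\<lambda>x. p x * q x)"
proof -
  let ?M = "\<lambda>(\<alpha> :: 'n \<Rightarrow> nat) x. \<Prod>i\<in>UNIV. (x :: real^'n) $ i ^ \<alpha> i"
  from assms obtain a b where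
    p: "\<And>x. p x = (\<Sum>\<alpha> | sum \<alpha> UNIV \<le> d. a \<alpha> * ?M \<alpha> x)" and
    q: "\<And>x. q x = (\<Sum>\<beta> | sum \<beta> UNIV \<le> e. b \<beta> * ?M \<beta> x)"
    unfolding poly_fun_deg_le_def by auto
  have "p x * q x = (\<Sum>\<alpha> | sum \<alpha> UNIV \<le> d. \<Sum>\<beta> | sum \<beta> UNIV \<le> e.
      a \<alpha> * b \<beta> * ?M (\<lambda>i. \<alpha> i + \<beta> i) x)" for x
    unfolding p q sum_product
    by (intro sum.cong) (simp_all add: power_add prod.distrib algebra_simps)
  then show ?thesis
    by (auto intro!: poly_fun_deg_le_sum poly_fun_deg_le_monomial simp: sum.distrib)
qed

lemma poly_fun_deg_le_cmult:
  fixes p :: "real^'n::finite \<Rightarrow> real"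
  assumes "poly_fun_deg_le d p"
  shows "poly_fun_deg_le d (\<lambda>x. k * p x)"
  \<comment> \<open>The constant is taken at degree 0, so that the bound of the product is again
    \<open>d\<close>.\<close>
  using poly_fun_deg_le_mult[OF poly_fun_deg_le_const[of 0 k] assms] by simp

lemma poly_fun_deg_le_diff:
  fixes p q :: "real^'n::finite \<Rightarrow> real"
  assumes "poly_fun_deg_le d p" "poly_fun_deg_le d q"
  shows "poly_fun_deg_le d (\<lambda>x. p x - q x)"
  using poly_fun_deg_le_add[OF assms(1) poly_fun_deg_le_cmult[OF assms(2), of "-1"]] by simp

lemmas poly_fun_deg_le_affine_intros =
  poly_fun_deg_le_add poly_fun_deg_le_diff poly_fun_deg_le_sum poly_fun_deg_le_cmult
  poly_fun_deg_le_coord poly_fun_deg_le_const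

section \<open>Projective maps\<close>

lemma matrix_add_rdistrib:
  fixes A B :: "real^'n^'m"
  shows "(A + B) ** C = A ** C + B ** C"
  by (simp add: matrix_matrix_mult_def vec_eq_iff sum.distrib ring_distribs)

lemma matrix_diff_ldistrib:
  fixes A :: "real^'n^'m"
  shows "A ** (B - C) = A ** B - A ** C"
  by (simp add: matrix_matrix_mult_def vec_eq_iff sum_subtractf ring_distribs)

lemma matrix_diff_rdistrib:
  fixes A B :: "real^'n^'m"
  shows "(A - B) ** C = A ** C - B ** C"
  by (simp add: matrix_matrix_mult_def vec_eq_iff sum_subtractf ring_distribs)

text \<open>\<open>matrix_inv\<close> is a choice among two-sided inverses, and any such
  \<open>C\<close> satisfies \<open>C = C ** (A ** B) = (C ** A) ** B = B\<close>.\<close>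

lemma matrix_inv_unique:
  fixes A :: "'a::semiring_1^'n^'m"
  assumes "A ** B = mat 1" "B ** A = mat 1"
  shows "matrix_inv A = B"
  unfolding matrix_inv_def
proof (rule some_equality)
  fix C assume "A ** C = mat 1 \<and> C ** A = mat 1"
  then show "C = B"
    by (metis assms(1) matrix_mul_assoc matrix_mul_lid matrix_mul_rid)
qed (use assms in simp)

definition outer :: "real^'m \<Rightarrow> real^'n \<Rightarrow> real^'n^'m" where
  "outer u v = (\<chi> i j. u $ i * v $ j)"

lemma outer_vector_mult: "outer u v *v x = (v \<bullet> x) *\<^sub>R u"
  by (simp add: outer_def matrix_vector_mult_def inner_vec_def vec_eq_iff sum_distrib_left
      mult_ac)

lemma matrix_mult_outer: "(M :: real^_^_) ** outer u v = outer (M *v u) v"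
  by (simp add: outer_def matrix_vector_mult_def matrix_matrix_mult_def vec_eq_iff
      sum_distrib_left mult_ac)

lemma outer_matrix_mult: "outer u v ** M = outer u (v v* M)"
  by (auto simp: outer_def vector_matrix_mult_def matrix_matrix_mult_def vec_eq_iff
      sum_distrib_left mult_ac intro!: sum.cong)

lemma sum_option: "(\<Sum>k\<in>(UNIV :: 'n::finite option set). f k) = (\<Sum>k\<in>UNIV. f (Some k)) + f None"
  by (simp add: UNIV_option_conv sum.reindex add.commute)

text \<open>Each entry of \<open>g ** h\<close> is a sum over \<open>'n option\<close>. By
  \<open>sum_option\<close> its \<open>Some\<close> part is the first summand on the right and its
  \<open>None\<close> part the second.\<close>

lemma block_mult:
  fixes g h :: "'n::finite bordered"
  shows "blockA (g ** h) = blockA g ** blockA h + outer (blockb g) (blockc h)"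
    and "blockb (g ** h) = blockA g *v blockb h + blockd h *\<^sub>R blockb g"
    and "blockc (g ** h) = blockc g v* blockA h + blockd g *\<^sub>R blockc h"
    and "blockd (g ** h) = blockc g \<bullet> blockb h + blockd g * blockd h"
  by (simp_all add: blockA_def blockb_def blockc_def blockd_def outer_def vec_eq_iff
      matrix_matrix_mult_def matrix_vector_mult_def vector_matrix_mult_def inner_vec_def
      sum_option mult_ac)

lemma block_mat_1:
  shows "blockA (mat 1) = mat 1" "blockb (mat 1) = 0" "blockc (mat 1) = 0" "blockd (mat 1) = 1"
  by (simp_all add: blockA_def blockb_def blockc_def blockd_def mat_def vec_eq_iff)

text \<open>This is the quotient rule. In the term coming from the denominator, one factor
  \<open>1 / proj_denom g m\<close> is absorbed by the numerator
  \<open>blockA g *v m + blockb g\<close>, which turns it back into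
  \<open>proj_map g m\<close>.\<close>

lemma jacobian_proj_map:
  fixes g :: "'n::finite bordered"
  assumes "proj_denom g m \<noteq> 0"
  shows "jacobian (proj_map g) (at m) =
    (1 / proj_denom g m) *\<^sub>R (blockA g - outer (proj_map g m) (blockc g))"
proof -
  let ?J = "(1 / proj_denom g m) *\<^sub>R (blockA g - outer (proj_map g m) (blockc g))"
  have "((\<lambda>x. inverse (blockc g \<bullet> x + blockd g) *\<^sub>R (blockA g *v x + blockb g))
      has_derivative (\<lambda>x. ?J *v x)) (at m)"
    using assms unfolding proj_denom_def
    by (auto intro!: derivative_eq_intros ext
        matrix_vector_mul_bounded_linear[THEN bounded_linear.has_derivative]
        simp: proj_map_def proj_denom_def outer_vector_mult scaleR_matrix_vector_assoc[symmetric]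
          matrix_vector_mult_diff_rdistrib divide_inverse algebra_simps)
  then have "(proj_map g has_derivative (\<lambda>x. ?J *v x)) (at m)"
    by (simp add: proj_map_def[abs_def] proj_denom_def divide_inverse)
  then show ?thesis
    unfolding jacobian_def using frechet_derivative_at[symmetric] matrix_of_matrix_vector_mul
    by fastforce
qed

lemma proj_denom_scaleR_proj_map:
  assumes "proj_denom g m \<noteq> 0"
  shows "proj_denom g m *\<^sub>R proj_map g m = blockA g *v m + blockb g"
  using assms by (simp add: proj_map_def)

section \<open>Inverse Jacobian and \<open>T_action\<close> in terms of the blocks of the inverse
  matrix\<close>

context
  fixes g h :: "'n::finite bordered"
  assumes gh: "g ** h = mat 1"
begin

text \<open>The first two identities are blocks of \<open>g ** h = mat 1\<close>. The other four are
  blocks of \<open>h ** g = mat 1\<close>, with those involving \<open>blockA g\<close> applied to a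
  vector for use as rewrite rules.\<close>

lemma block_right_inverse:
  shows "blockA g ** blockA h = mat 1 - outer (blockb g) (blockc h)"
    and "blockc g v* blockA h = - blockd g *\<^sub>R blockc h"
    and "blockA h *v (blockA g *v x) = x - (blockc g \<bullet> x) *\<^sub>R blockb h"
    and "blockA h *v blockb g = - blockd g *\<^sub>R blockb h"
    and "blockc h \<bullet> (blockA g *v x) = - blockd h * (blockc g \<bullet> x)"
    and "blockc h \<bullet> blockb g = 1 - blockd h * blockd g"
proof -
  note r = block_mult[of g h, unfolded gh block_mat_1]
  have "h ** g = mat 1"
    using gh by (simp add: matrix_left_right_inverse)
  note l = block_mult[of h g, unfolded this block_mat_1]
  show "blockA g ** blockA h = mat 1 - outer (blockb g) (blockc h)"
    using r(1) by (simp add: algebra_simps)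
  show "blockc g v* blockA h = - blockd g *\<^sub>R blockc h"
    using r(3) by (simp add: eq_neg_iff_add_eq_0)
  have "x = (blockA h ** blockA g + outer (blockb h) (blockc g)) *v x"
    unfolding l(1)[symmetric] by simp
  then show "blockA h *v (blockA g *v x) = x - (blockc g \<bullet> x) *\<^sub>R blockb h"
    by (simp add: matrix_vector_mult_add_rdistrib outer_vector_mult matrix_vector_mul_assoc
        algebra_simps)
  show "blockA h *v blockb g = - blockd g *\<^sub>R blockb h"
    using l(2) by (simp add: eq_neg_iff_add_eq_0)
  have "blockc h v* blockA g = - blockd h *\<^sub>R blockc g"
    using l(3) by (simp add: eq_neg_iff_add_eq_0)
  then show "blockc h \<bullet> (blockA g *v x) = - blockd h * (blockc g \<bullet> x)"
    by (metis dot_lmul_matrix inner_scaleR_left)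
  show "blockc h \<bullet> blockb g = 1 - blockd h * blockd g"
    using l(4) by simp
qed

text \<open>Multiplying by the denominator replaces \<open>proj_map g m\<close> by
  \<open>blockA g *v m + blockb g\<close>. The block identities then make the terms \<open>m\<close>
  and \<open>- m\<close> cancel, and the rest has the factor \<open>proj_denom g m\<close>.\<close>

lemma inverse_factor_proj_map:
  assumes "proj_denom g m \<noteq> 0"
  shows "(blockA h - outer m (blockc h)) *v proj_map g m = blockd h *\<^sub>R m - blockb h"
proof -
  have "proj_denom g m *\<^sub>R ((blockA h - outer m (blockc h)) *v proj_map g m) =
      (blockA h - outer m (blockc h)) *v (blockA g *v m + blockb g)"
    by (metis proj_denom_scaleR_proj_map[OF assms] matrix_vector_mult_scaleR)
  also have "\<dots> = proj_denom g m *\<^sub>R (blockd h *\<^sub>R m - blockb h)"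
    by (simp add: matrix_vector_mult_diff_rdistrib matrix_vector_right_distrib outer_vector_mult
        inner_add_right block_right_inverse proj_denom_def algebra_simps)
  finally show ?thesis
    using assms by simp
qed

text \<open>The inverse is verified by multiplying out: the two rank-one corrections cancel because
  \<open>proj_denom g m *\<^sub>R proj_map g m\<close> is the numerator
  \<open>blockA g *v m + blockb g\<close>.\<close>

lemma jacobian_proj_map_inverse:
  assumes "proj_denom g m \<noteq> 0"
  shows "jacobian (proj_map g) (at m) ** (proj_denom g m *\<^sub>R (blockA h - outer m (blockc h))) = mat 1"
proof -
  let ?y = "proj_map g m"
  have "(blockA g - outer ?y (blockc g)) ** (blockA h - outer m (blockc h)) =
      mat 1 - outer (blockA g *v m + blockb g) (blockc h)
        + outer (proj_denom g m *\<^sub>R ?y) (blockc h)"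
    by (simp add: matrix_diff_ldistrib matrix_diff_rdistrib matrix_mult_outer outer_matrix_mult
        block_right_inverse outer_vector_mult matrix_vector_mult_diff_rdistrib)
      (simp add: outer_def vec_eq_iff proj_denom_def algebra_simps)
  also have "\<dots> = mat 1"
    by (simp add: proj_denom_scaleR_proj_map[OF assms])
  finally show ?thesis
    using assms by (simp add: jacobian_proj_map matrix_scalar_ac scalar_matrix_assoc[symmetric])
qed

text \<open>The two inverse Jacobians contribute the square of \<open>proj_denom g m\<close>. The
  prefactor of \<open>T_action\<close> removes one power, and the other is attached to
  \<open>V\<close> to clear its denominators.\<close>

lemma T_action_eq:
  assumes "proj_denom g m \<noteq> 0"
  shows "T_action g V m = (blockA h - outer m (blockc h)) **
    (proj_denom g m *\<^sub>R V (proj_map g m)) ** transpose (blockA h - outer m (blockc h))"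
proof -
  let ?J = "jacobian (proj_map g) (at m)"
  let ?N = "proj_denom g m *\<^sub>R (blockA h - outer m (blockc h))"
  have 1: "?J ** ?N = mat 1"
    by (rule jacobian_proj_map_inverse[OF assms])
  then have 2: "?N ** ?J = mat 1"
    by (simp add: matrix_left_right_inverse)
  have "matrix_inv ?J = ?N"
    by (rule matrix_inv_unique[OF 1 2])
  \<comment> \<open>Transposition reverses products, so facts 1 and 2 exchange roles.\<close>
  moreover have "matrix_inv (transpose ?J) = transpose ?N"
    by (rule matrix_inv_unique) (simp_all only: matrix_transpose_mul[symmetric] 1 2 transpose_mat)
  ultimately show ?thesis
    using assms by (simp add: T_action_def Let_def transpose_scalar matrix_scalar_ac
        scalar_matrix_assoc[symmetric])
qed

end

theorem theorem5p2:
  fixes g :: "'n::finite bordered"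
    and F :: "(real^'n) measure set"
  assumes "invertible g"
    and "F \<in> SM2"
  shows "\<exists>P :: real^'n \<Rightarrow> real^'n^'n.
      (\<forall>i j. poly_fun_deg_le 3 (\<lambda>m. P m $ i $ j)) \<and>
      (\<forall>m \<in> proj_domain g (means_domain F). T_action g (variance_function F) m = P m)"
proof -
  from assms(1) obtain h where gh: "g ** h = mat 1"
    unfolding invertible_def by auto
  from assms(2) obtain a B C where V: "\<And>m. m \<in> means_domain F \<Longrightarrow>
      variance_function F m = a *\<^sub>R outer m m + (\<Sum>i\<in>UNIV. m $ i *\<^sub>R B i) + C"
    unfolding SM2_def outer_def by auto
  define K where "K m = blockA h - outer m (blockc h)" for m
  define w where "w m = blockd h *\<^sub>R m - blockb h" for m
  \<comment> \<open>\<open>L\<close> is the denominator times the affine part of the variance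
    function at \<open>proj_map g m\<close>, with the division already carried out.\<close>
  define L where "L m = (\<Sum>i\<in>UNIV. (blockA g *v m + blockb g) $ i *\<^sub>R B i) + proj_denom g m *\<^sub>R C"
    for m
  \<comment> \<open>\<open>poly_fun_deg_le\<close> concerns all of space, so \<open>P\<close> is
    written without division and agrees with \<open>T_action\<close> only on the domain.\<close>
  define P where "P m = (a * proj_denom g m) *\<^sub>R outer (w m) (w m) + K m ** L m ** transpose (K m)"
    for m
  have "poly_fun_deg_le 3 (\<lambda>m. P m $ i $ j)" for i j
  proof -
    have w: "poly_fun_deg_le 1 (\<lambda>m. w m $ k)" for k
      unfolding w_def vector_minus_component vector_scaleR_component real_scaleR_def
      by (intro poly_fun_deg_le_affine_intros order_refl)
    have K: "poly_fun_deg_le 1 (\<lambda>m. K m $ k $ l)" for k l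
      \<comment> \<open>Commuting the product puts the constant on the left, as
        \<open>poly_fun_deg_le_cmult\<close> expects.\<close>
      unfolding K_def outer_def vector_minus_component vec_lambda_beta mult.commute[of "_ $ k"]
      by (intro poly_fun_deg_le_affine_intros order_refl)
    have \<delta>: "poly_fun_deg_le 1 (proj_denom g)"
      unfolding proj_denom_def[abs_def] inner_vec_def inner_real_def
      by (intro poly_fun_deg_le_affine_intros order_refl)
    have L: "poly_fun_deg_le 1 (\<lambda>m. L m $ k $ l)" for k l
    proof -
      have "L m $ k $ l = (\<Sum>i\<in>UNIV. B i $ k $ l * ((\<Sum>j\<in>UNIV. blockA g $ i $ j * m $ j) + blockb g $ i))
          + C $ k $ l * proj_denom g m" for m
        by (simp add: L_def matrix_vector_mult_def mult.commute)
      then show ?thesis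
        by (simp only:) (intro poly_fun_deg_le_affine_intros order_refl \<delta>)
    qed
    have "P m $ i $ j = a * (proj_denom g m * w m $ i * w m $ j) +
        (\<Sum>k\<in>UNIV. \<Sum>l\<in>UNIV. K m $ i $ l * L m $ l $ k * K m $ j $ k)" for m
      by (simp add: P_def outer_def matrix_matrix_mult_def transpose_def sum_distrib_left mult_ac)
    \<comment> \<open>The bound \<open>1 + 1 + 1\<close> is bracketed like the triple products, so
      that \<open>poly_fun_deg_le_mult\<close> unifies with it.\<close>
    moreover have "poly_fun_deg_le (1 + 1 + 1) (\<lambda>m. a * (proj_denom g m * w m $ i * w m $ j) +
        (\<Sum>k\<in>UNIV. \<Sum>l\<in>UNIV. K m $ i $ l * L m $ l $ k * K m $ j $ k))"
      by (intro poly_fun_deg_le_add poly_fun_deg_le_sum poly_fun_deg_le_cmult poly_fun_deg_le_mult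
          w K L \<delta>)
    ultimately show ?thesis
      by (simp add: numeral_3_eq_3)
  qed
  moreover have "T_action g (variance_function F) m = P m"
    if "m \<in> proj_domain g (means_domain F)" for m
  proof -
    let ?\<delta> = "proj_denom g m" and ?y = "proj_map g m"
    from that have \<delta>: "?\<delta> \<noteq> 0" and y: "?y \<in> means_domain F"
      by (auto simp: proj_domain_def)
    \<comment> \<open>The quadratic part still contains denominators here; they disappear only after
      multiplication by \<open>K m\<close> on both sides.\<close>
    have "?\<delta> *\<^sub>R variance_function F ?y = (a * ?\<delta>) *\<^sub>R outer ?y ?y + L m"
      unfolding L_def proj_denom_scaleR_proj_map[OF \<delta>, symmetric] V[OF y]
      by (simp add: scaleR_right_distrib scaleR_sum_right mult_ac)
    moreover have "K m ** outer ?y ?y ** transpose (K m) = outer (w m) (w m)"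
      by (simp add: matrix_mult_outer outer_matrix_mult vector_transpose_matrix K_def w_def
          inverse_factor_proj_map[OF gh \<delta>])
    ultimately show ?thesis
      unfolding T_action_eq[OF gh \<delta>] P_def K_def[symmetric]
      by (simp add: matrix_add_ldistrib matrix_add_rdistrib matrix_scalar_ac
          scalar_matrix_assoc[symmetric])
  qed
  ultimately show ?thesis
    by blast
qed

end
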